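(* Let $\mathcal{S}=\langle S,s_0,\tau,l\rangle$ be a $\Gamma$-labeled $\Upsilon$-transition system over input propositions $I$ and output propositions $O$, let $n\ge1$, $m\ge 0$, let $\varphi$ be a quantifier-free HyperLTL formula over $\mathrm{AP}=I\cup O$ with free trace variables among $\pi_1,\dots,\pi_n,\pi'_1,\dots,\pi'_m$, let $\psi$ be a quantifier-free HyperLTL formula over $\mathrm{AP}$ whose trace variables are among the universally quantified variables $\pi_1,\dots,\pi_n$, and let $p\notin\mathrm{AP}$ be a fresh atomic proposition. Then $\mathcal{S}\models\forall\pi_1\ldots\forall\pi_n.\ \exists\pi'_1\ldots\exists\pi'_m.\ \varphi$ if and only if $\mathcal{S}^{\{p\}}\models\forall\pi_1\ldots\forall\pi_n.\ \exists\pi'_1\ldots\exists\pi'_m.\ \mathsf{G}(p_{\pi_1}\leftrightarrow\psi)\rightarrow\varphi.$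
   Context: $\Upsilon=2^I$, $\Gamma=2^O$, $\Sigma=2^{\mathrm{AP}}$. A $\Gamma$-labeled $\Upsilon$-transition system $\mathcal{S}=\langle S,s_0,\tau,l\rangle$ has finite $S$, $s_0\in S$, $\tau\colon S\times\Upsilon\to S$, $l\colon S\to\Gamma$; $\tau^*(\epsilon)=s_0$, $\tau^*(x\upsilon)=\tau(\tau^*(x),\upsilon)$. The trace of $\mathcal{S}$ on $\upsilon_0\upsilon_1\ldots\in\Upsilon^\omega$ is $(\upsilon_0\cup\gamma_0)(\upsilon_1\cup\gamma_1)\ldots$ with $\gamma_i=l(\tau^*(\upsilon_0\cdots\upsilon_{i-1}))$, and $\mathit{traces}(\mathcal{S})$ is the set of all such traces. For a set $P$ of fresh propositions, $\mathcal{S}^P=\langle S,s_0,\tau^P,l\rangle$ is the $\Gamma$-labeled $2^{I\cup P}$-transition system with $\tau^P(s,\upsilon)=\tau(s,\upsilon\setminus P)$, i.e., the additional inputs $P$ are unconstrained and do not affect the behavior. HyperLTL: $\varphi::=\forall\pi.\varphi\mid\exists\pi.\varphi\mid\psi$, $\psi::=a_\pi\mid\neg\psi\mid\psi\vee\psi\mid\mathsf{X}\psi\mid\psi\mathsf{U}\psi$, with derived $\rightarrow,\leftrightarrow,\mathsf{F},\mathsf{G}$; under an assignment $\Pi$ of traces to variables, $a_\pi$ holds at position $i$ iff $a\in\Pi(\pi)[i]$, temporal operators have the standard LTL semantics, and $\exists\pi$/$\forall\pi$ range over the traces of the system; $\mathcal{S}\models\varphi$ iff $\varphi$ holds at position $0$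 under the empty assignment with quantifiers over $\mathit{traces}(\mathcal{S})$. *)

theory Defs imports Main begin

type_synonym 'a word = "nat \<Rightarrow> 'a set"

text \<open>
  Transition systems whose transitions read a subset of the input propositions and whose states
  are labeled with subsets of the output propositions. The transition function and the labeling
  are total on the underlying types; only their restrictions to \<open>states\<close> and to subsets of
  \<open>inputs\<close> are relevant.
\<close>

record ('s, 'a) tsys =
  inputs :: "'a set"
  outputs :: "'a set"
  states :: "'s set"
  init :: 's
  step :: "'s \<Rightarrow> 'a set \<Rightarrow> 's"
  label :: "'s \<Rightarrow> 'a set"

locale transition_system =
  fixes S :: "('s, 'a) tsys"
  assumes finite_states: "finite (states S)"
    and init_in_states: "init S \<in> states S"
    and step_in_states: "\<lbrakk>s \<in> states S; \<upsilon> \<subseteq> inputs S\<rbrakk> \<Longrightarrow> step S s \<upsilon> \<in> states S"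
    and label_outputs: "s \<in> states S \<Longrightarrow> label S s \<subseteq> outputs S"

definition AP :: "('s, 'a) tsys \<Rightarrow> 'a set" where
  "AP S = inputs S \<union> outputs S"

definition step_star :: "('s, 'a) tsys \<Rightarrow> 'a set list \<Rightarrow> 's" where
  "step_star S = foldl (step S) (init S)"

lemma step_star_simps [simp]:
  "step_star S [] = init S"
  "step_star S (x @ [\<upsilon>]) = step S (step_star S x) \<upsilon>"
  by (simp_all add: step_star_def)

definition trace :: "('s, 'a) tsys \<Rightarrow> 'a word \<Rightarrow> 'a word" where
  "trace S w = (\<lambda>i. w i \<union> label S (step_star S (map w [0..<i])))"

definition traces :: "('s, 'a) tsys \<Rightarrow> 'a word set" where
  "traces S = {trace S w | w. \<forall>i. w i \<subseteq> inputs S}"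

text \<open>The system \<open>S\<^sup>P\<close> with the additional, unconstrained inputs \<open>P\<close>.\<close>

definition add_inputs :: "'a set \<Rightarrow> ('s, 'a) tsys \<Rightarrow> ('s, 'a) tsys" where
  "add_inputs P S = S\<lparr>inputs := inputs S \<union> P, step := (\<lambda>s \<upsilon>. step S s (\<upsilon> - P))\<rparr>"

lemma transition_system_add_inputs:
  assumes "transition_system S"
  shows "transition_system (add_inputs P S)"
proof -
  interpret transition_system S by fact
  show ?thesis
    by unfold_locales
      (auto simp: add_inputs_def finite_states init_in_states
        dest: label_outputs[THEN subsetD] intro!: step_in_states)
qed

text \<open>Quantifier-free HyperLTL formulas; \<open>Atom a \<pi>\<close> stands for \<open>a\<^sub>\<pi>\<close>.\<close>

datatype (props: 'a, tvars: 'v) qfree =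
    Atom 'a 'v
  | Neg "('a, 'v) qfree"
  | Disj "('a, 'v) qfree" "('a, 'v) qfree"
  | Next "('a, 'v) qfree"
  | Until "('a, 'v) qfree" "('a, 'v) qfree"

datatype ('a, 'v) hyperltl =
    Forall 'v "('a, 'v) hyperltl"
  | Exists 'v "('a, 'v) hyperltl"
  | QFree "('a, 'v) qfree"

definition Conj :: "('a, 'v) qfree \<Rightarrow> ('a, 'v) qfree \<Rightarrow> ('a, 'v) qfree" where
  "Conj \<phi> \<psi> = Neg (Disj (Neg \<phi>) (Neg \<psi>))"

definition Imp :: "('a, 'v) qfree \<Rightarrow> ('a, 'v) qfree \<Rightarrow> ('a, 'v) qfree" where
  "Imp \<phi> \<psi> = Disj (Neg \<phi>) \<psi>"

definition Iff :: "('a, 'v) qfree \<Rightarrow> ('a, 'v) qfree \<Rightarrow> ('a, 'v) qfree" where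
  "Iff \<phi> \<psi> = Conj (Imp \<phi> \<psi>) (Imp \<psi> \<phi>)"

text \<open>
  The grammar has no constant for truth; in \<open>F \<psi> = true U \<psi>\<close> it is rendered by the tautology
  \<open>\<psi> \<or> \<not> \<psi>\<close>, which introduces no further propositions or trace variables.
\<close>

definition Finally :: "('a, 'v) qfree \<Rightarrow> ('a, 'v) qfree" where
  "Finally \<psi> = Until (Disj \<psi> (Neg \<psi>)) \<psi>"

definition Globally :: "('a, 'v) qfree \<Rightarrow> ('a, 'v) qfree" where
  "Globally \<psi> = Neg (Finally (Neg \<psi>))"

text \<open>
  Trace assignments are partial. An atom over an unassigned trace variable is false, which does
  not affect closed formulas.
\<close>

type_synonym ('a, 'v) assignment = "'v \<rightharpoonup> 'a word"

primrec qfree_sat :: "('a, 'v) assignment \<Rightarrow> nat \<Rightarrow> ('a, 'v) qfree \<Rightarrow> bool" where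
  "qfree_sat \<Pi> i (Atom a \<pi>) = (case \<Pi> \<pi> of None \<Rightarrow> False | Some t \<Rightarrow> a \<in> t i)"
| "qfree_sat \<Pi> i (Neg \<psi>) = (\<not> qfree_sat \<Pi> i \<psi>)"
| "qfree_sat \<Pi> i (Disj \<psi>1 \<psi>2) = (qfree_sat \<Pi> i \<psi>1 \<or> qfree_sat \<Pi> i \<psi>2)"
| "qfree_sat \<Pi> i (Next \<psi>) = qfree_sat \<Pi> (Suc i) \<psi>"
| "qfree_sat \<Pi> i (Until \<psi>1 \<psi>2) =
    (\<exists>j\<ge>i. qfree_sat \<Pi> j \<psi>2 \<and> (\<forall>k. i \<le> k \<and> k < j \<longrightarrow> qfree_sat \<Pi> k \<psi>1))"

primrec sat :: "'a word set \<Rightarrow> ('a, 'v) assignment \<Rightarrow> nat \<Rightarrow> ('a, 'v) hyperltl \<Rightarrow> bool" where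
  "sat T \<Pi> i (Forall \<pi> \<phi>) = (\<forall>t\<in>T. sat T (\<Pi>(\<pi> \<mapsto> t)) i \<phi>)"
| "sat T \<Pi> i (Exists \<pi> \<phi>) = (\<exists>t\<in>T. sat T (\<Pi>(\<pi> \<mapsto> t)) i \<phi>)"
| "sat T \<Pi> i (QFree \<psi>) = qfree_sat \<Pi> i \<psi>"

definition models :: "('s, 'a) tsys \<Rightarrow> ('a, 'v) hyperltl \<Rightarrow> bool" (infix "\<Turnstile>" 50) where
  "S \<Turnstile> \<phi> \<longleftrightarrow> sat (traces S) Map.empty 0 \<phi>"

lemma qfree_sat_derived [simp]:
  "qfree_sat \<Pi> i (Conj \<phi> \<psi>) \<longleftrightarrow> qfree_sat \<Pi> i \<phi> \<and> qfree_sat \<Pi> i \<psi>"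
  "qfree_sat \<Pi> i (Imp \<phi> \<psi>) \<longleftrightarrow> (qfree_sat \<Pi> i \<phi> \<longrightarrow> qfree_sat \<Pi> i \<psi>)"
  "qfree_sat \<Pi> i (Iff \<phi> \<psi>) \<longleftrightarrow> (qfree_sat \<Pi> i \<phi> \<longleftrightarrow> qfree_sat \<Pi> i \<psi>)"
  "qfree_sat \<Pi> i (Finally \<psi>) \<longleftrightarrow> (\<exists>j\<ge>i. qfree_sat \<Pi> j \<psi>)"
  "qfree_sat \<Pi> i (Globally \<psi>) \<longleftrightarrow> (\<forall>j\<ge>i. qfree_sat \<Pi> j \<psi>)"
  by (auto simp: Conj_def Imp_def Iff_def Finally_def Globally_def)

definition Foralls :: "'v list \<Rightarrow> ('a, 'v) hyperltl \<Rightarrow> ('a, 'v) hyperltl" where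
  "Foralls \<pi>s \<phi> = foldr Forall \<pi>s \<phi>"

definition Existss :: "'v list \<Rightarrow> ('a, 'v) hyperltl \<Rightarrow> ('a, 'v) hyperltl" where
  "Existss \<pi>s \<phi> = foldr Exists \<pi>s \<phi>"

end

(*
  The traces of S^P are the words that become traces of S once the propositions in P are erased,
  and erasing P does not change the truth of formulas that do not mention P. Given traces of S,
  the first one can be decorated with p exactly at the positions where psi holds; this is a trace
  of S^{p}, and the decoration makes the premise G (p <-> psi) true.
*)
theory Submission imports Defs begin

definition erase :: "'a set \<Rightarrow> 'a word \<Rightarrow> 'a word" where
  "erase P t = (\<lambda>i. t i - P)"

lemma step_star_add_inputs:
  "step_star (add_inputs P S) us = step_star S (map (\<lambda>u. u - P) us)"
  by (induction us rule: rev_induct) (simp_all add: add_inputs_def step_star_def)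

lemma trace_add_inputs:
  "trace (add_inputs P S) w = (\<lambda>i. w i \<union> label S (step_star S (map (erase P w) [0..<i])))"
  by (simp add: trace_def step_star_add_inputs comp_def erase_def) (simp add: add_inputs_def)

lemma (in transition_system) step_star_in_states:
  "(\<And>u. u \<in> set us \<Longrightarrow> u \<subseteq> inputs S) \<Longrightarrow> step_star S us \<in> states S"
  by (induction us rule: rev_induct) (auto simp: init_in_states intro!: step_in_states)

text \<open>Labels lie in the outputs, so erasing a fresh \<open>P\<close> changes only the input
  part of a letter, and the extended run already ignores \<open>P\<close>. Conversely, any
  \<open>P\<close>-part can be put back, because these inputs are unconstrained.\<close>

lemma (in transition_system) traces_add_inputs:
  assumes "P \<inter> AP S = {}"
  shows "traces (add_inputs P S) = {t. erase P t \<in> traces S}"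
proof (intro set_eqI iffI; unfold mem_Collect_eq)
  have label_fresh: "label S (step_star S (map w [0..<i])) - P = label S (step_star S (map w [0..<i]))"
    if "\<And>i. w i \<subseteq> inputs S" for w i
    using label_outputs[OF step_star_in_states, of "map w [0..<i]"] that assms
    by (fastforce simp: AP_def)
  fix t
  {
    assume "t \<in> traces (add_inputs P S)"
    then obtain w where w: "\<And>i. w i \<subseteq> inputs S \<union> P" and t: "t = trace (add_inputs P S) w"
      by (auto simp: traces_def add_inputs_def)
    have w': "erase P w i \<subseteq> inputs S" for i
      using w[of i] by (auto simp: erase_def)
    have "erase P t = trace S (erase P w)"
      using label_fresh[OF w'] unfolding t trace_add_inputs
      by (auto simp: trace_def erase_def fun_eq_iff Un_Diff)
    with w' show "erase P t \<in> traces S"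
      by (auto simp: traces_def)
  next
    assume "erase P t \<in> traces S"
    then obtain w where w: "\<And>i. w i \<subseteq> inputs S" and t: "erase P t = trace S w"
      by (auto simp: traces_def)
    \<comment> \<open>The input word that produces \<open>t\<close>: since \<open>w\<close> contains
      nothing from \<open>P\<close>, adding the \<open>P\<close>-part of \<open>t\<close> is undone
      exactly by erasure, so both words drive the same run.\<close>
    define v where "v = (\<lambda>i. w i \<union> (t i \<inter> P))"
    have "erase P v = w"
      using w assms by (fastforce simp: v_def erase_def AP_def fun_eq_iff)
    moreover have "t i = v i \<union> label S (step_star S (map w [0..<i]))" for i
    proof -
      have "t i = (t i \<inter> P) \<union> erase P t i"
        by (auto simp: erase_def)
      then show ?thesis
        unfolding t by (auto simp: trace_def v_def)
    qed
    ultimately have "t = trace (add_inputs P S) v"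
      unfolding trace_add_inputs by auto
    moreover have "v i \<subseteq> inputs (add_inputs P S)" for i
      using w[of i] by (auto simp: v_def add_inputs_def)
    ultimately show "t \<in> traces (add_inputs P S)"
      by (auto simp: traces_def)
  }
qed

text \<open>Every letter of a trace of \<open>S\<close> lies within \<open>AP S\<close>. With
  \<open>traces_add_inputs\<close>, each trace of \<open>S\<close> is thus also a trace of the
  extended system.\<close>

lemma (in transition_system) erase_traces:
  assumes "P \<inter> AP S = {}" and "t \<in> traces S"
  shows "erase P t = t"
proof -
  from assms(2) obtain w where w: "\<And>i. w i \<subseteq> inputs S" and t: "t = trace S w"
    by (auto simp: traces_def)
  have "t i \<subseteq> AP S" for i
    using w label_outputs[OF step_star_in_states, of "map w [0..<i]"]
    by (fastforce simp: t trace_def AP_def)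
  with assms(1) show ?thesis
    by (fastforce simp: erase_def fun_eq_iff)
qed

text \<open>Truth depends on the traces only through atoms, and no atom of \<open>\<phi>\<close> has
  its proposition in \<open>P\<close>. \<open>map_option\<close> keeps unassigned variables
  unassigned.\<close>

lemma qfree_sat_erase:
  assumes "props \<phi> \<inter> P = {}"
  shows "qfree_sat (map_option (erase P) \<circ> \<Pi>) i \<phi> \<longleftrightarrow> qfree_sat \<Pi> i \<phi>"
  using assms
proof (induction \<phi> arbitrary: i)
  case (Atom a \<pi>)
  then show ?case by (auto simp: erase_def split: option.split)
qed (auto simp: Int_Un_distrib2)

lemma qfree_sat_cong:
  assumes "\<And>\<pi>. \<pi> \<in> tvars \<phi> \<Longrightarrow> \<Pi> \<pi> = \<Pi>' \<pi>"
  shows "qfree_sat \<Pi> i \<phi> \<longleftrightarrow> qfree_sat \<Pi>' i \<phi>"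
  using assms by (induction \<phi> arbitrary: i) auto

text \<open>Makes \<open>qfree_sat_erase\<close> applicable to assignments built from lists of
  traces.\<close>

lemma map_option_comp_map_upds:
  "length xs = length ts \<Longrightarrow>
    map_option f \<circ> \<Pi>(xs [\<mapsto>] ts) = (map_option f \<circ> \<Pi>)(xs [\<mapsto>] map f ts)"
proof (induction xs ts arbitrary: \<Pi> rule: list_induct2)
  case (Cons x xs t ts)
  have "map_option f \<circ> \<Pi>(x \<mapsto> t) = (map_option f \<circ> \<Pi>)(x \<mapsto> f t)"
    by auto
  with Cons.IH[of "\<Pi>(x \<mapsto> t)"] show ?case by (simp only: map_upds_Cons list.map)
qed simp

lemma ball_lists_Suc:
  "(\<forall>ts\<in>lists T. length ts = Suc n \<longrightarrow> Q ts) \<longleftrightarrow>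
    (\<forall>t\<in>T. \<forall>ts\<in>lists T. length ts = n \<longrightarrow> Q (t # ts))"
proof (intro iffI ballI impI)
  fix ts assume "\<forall>t\<in>T. \<forall>ts\<in>lists T. length ts = n \<longrightarrow> Q (t # ts)"
    and "ts \<in> lists T" "length ts = Suc n"
  then show "Q ts"
    by (cases ts) simp_all
qed simp

text \<open>Collapses a quantifier block into one quantification over lists, so that whole tuples of
  traces can be handled at once.\<close>

lemma sat_Foralls:
  "sat T \<Pi> i (Foralls \<pi>s \<phi>) \<longleftrightarrow>
    (\<forall>ts\<in>lists T. length ts = length \<pi>s \<longrightarrow> sat T (\<Pi>(\<pi>s [\<mapsto>] ts)) i \<phi>)"
proof (induction \<pi>s arbitrary: \<Pi>)
  case (Cons \<pi> \<pi>s)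
  then show ?case
    unfolding length_Cons ball_lists_Suc by (simp add: Foralls_def del: fun_upd_apply)
qed (simp add: Foralls_def)

lemma sat_Existss:
  "sat T \<Pi> i (Existss \<pi>s \<phi>) \<longleftrightarrow>
    (\<exists>ts\<in>lists T. length ts = length \<pi>s \<and> sat T (\<Pi>(\<pi>s [\<mapsto>] ts)) i \<phi>)"
proof -
  \<comment> \<open>Stated as a negated universal so that \<open>ball_lists_Suc\<close> serves here
    too.\<close>
  have "sat T \<Pi> i (Existss \<pi>s \<phi>) \<longleftrightarrow>
    \<not> (\<forall>ts\<in>lists T. length ts = length \<pi>s \<longrightarrow> \<not> sat T (\<Pi>(\<pi>s [\<mapsto>] ts)) i \<phi>)"
  proof (induction \<pi>s arbitrary: \<Pi>)
    case (Cons \<pi> \<pi>s)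
    then show ?case
      unfolding length_Cons ball_lists_Suc by (simp add: Existss_def del: fun_upd_apply)
  qed (simp add: Existss_def)
  then show ?thesis
    by blast
qed

theorem theorem5:
  fixes S :: "('s, 'a) tsys"
    and n m :: nat
    and \<pi>s \<pi>s' :: "'v list"
    and \<phi> \<psi> :: "('a, 'v) qfree"
    and p :: 'a
  assumes "transition_system S"
    and "n \<ge> 1" and "length \<pi>s = n" and "length \<pi>s' = m"
    and "distinct (\<pi>s @ \<pi>s')"
    and "props \<phi> \<subseteq> AP S" and "tvars \<phi> \<subseteq> set \<pi>s \<union> set \<pi>s'"
    and "props \<psi> \<subseteq> AP S" and "tvars \<psi> \<subseteq> set \<pi>s"
    and "p \<notin> AP S"
  shows "S \<Turnstile> Foralls \<pi>s (Existss \<pi>s' (QFree \<phi>)) \<longleftrightarrow>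
    add_inputs {p} S \<Turnstile>
      Foralls \<pi>s (Existss \<pi>s' (QFree (Imp (Globally (Iff (Atom p (hd \<pi>s)) \<psi>)) \<phi>)))"
proof -
  interpret transition_system S by fact
  let ?T = "traces S" and ?T' = "traces (add_inputs {p} S)"
  let ?e = "erase {p}"
  let ?\<Pi> = "\<lambda>ts ts'. Map.empty(\<pi>s [\<mapsto>] ts, \<pi>s' [\<mapsto>] ts')"
  let ?G = "Globally (Iff (Atom p (hd \<pi>s)) \<psi>)"
  have fresh: "{p} \<inter> AP S = {}" "props \<phi> \<inter> {p} = {}" "props \<psi> \<inter> {p} = {}"
    using assms by auto
  have T': "?T' = {t. ?e t \<in> ?T}"
    by (rule traces_add_inputs[OF fresh(1)])
  have e_id: "map ?e ts = ts" if "ts \<in> lists ?T" for ts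
    using that erase_traces[OF fresh(1)] by (auto simp: in_lists_conv_set intro!: map_idI)
  have in_T': "ts \<in> lists ?T' \<longleftrightarrow> map ?e ts \<in> lists ?T" for ts
    by (auto simp: T' in_lists_conv_set)
  have sat_e: "qfree_sat (?\<Pi> (map ?e ts) (map ?e ts')) i \<chi> \<longleftrightarrow> qfree_sat (?\<Pi> ts ts') i \<chi>"
    if "length ts = length \<pi>s" "length ts' = length \<pi>s'" "props \<chi> \<inter> {p} = {}" for ts ts' i \<chi>
    using qfree_sat_erase[OF that(3), of "?\<Pi> ts ts'"] that(1,2)
    by (simp add: map_option_comp_map_upds)
  have "(\<forall>ts\<in>lists ?T. length ts = length \<pi>s \<longrightarrow>
      (\<exists>ts'\<in>lists ?T. length ts' = length \<pi>s' \<and> qfree_sat (?\<Pi> ts ts') 0 \<phi>)) \<longleftrightarrow>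
    (\<forall>ts\<in>lists ?T'. length ts = length \<pi>s \<longrightarrow>
      (\<exists>ts'\<in>lists ?T'. length ts' = length \<pi>s' \<and> qfree_sat (?\<Pi> ts ts') 0 (Imp ?G \<phi>)))"
    (is "?L \<longleftrightarrow> ?R")
  proof (intro iffI ballI impI)
    fix ts assume L: ?L and ts: "ts \<in> lists ?T'" "length ts = length \<pi>s"
    \<comment> \<open>The witnesses for the erased tuple are traces of \<open>S\<close>, hence of
      the extended system; the implication then holds through its conclusion.\<close>
    obtain ts' where ts': "ts' \<in> lists ?T" "length ts' = length \<pi>s'"
      and sat: "qfree_sat (?\<Pi> (map ?e ts) ts') 0 \<phi>"
      using L[rule_format, of "map ?e ts"] ts in_T' by auto
    from sat have "qfree_sat (?\<Pi> ts ts') 0 \<phi>"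
      using sat_e[OF ts(2) ts'(2) fresh(2), of 0] e_id[OF ts'(1)] by simp
    with ts' show "\<exists>ts'\<in>lists ?T'. length ts' = length \<pi>s' \<and> qfree_sat (?\<Pi> ts ts') 0 (Imp ?G \<phi>)"
      using in_T'[of ts'] e_id[OF ts'(1)] by (intro bexI[of _ ts']) simp_all
  next
    fix ts assume R: ?R and ts: "ts \<in> lists ?T" "length ts = length \<pi>s"
    \<comment> \<open>\<open>n \<ge> 1\<close> provides the first trace, which is to carry
      \<open>p\<close>.\<close>
    obtain \<pi> \<sigma>s t us where split: "\<pi>s = \<pi> # \<sigma>s" "ts = t # us"
      using assms(2,3) ts(2) by (cases \<pi>s; cases ts) auto
    \<comment> \<open>The truth of \<open>\<psi>\<close> is settled by the universal traces alone,
      so the decoration can be fixed before any witness is chosen.\<close>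
    define d where
      "d = (\<lambda>i. t i \<union> (if qfree_sat (Map.empty(\<pi>s [\<mapsto>] ts)) i \<psi> then {p} else {}))"
    have "?e d = ?e t"
      by (simp add: d_def erase_def fun_eq_iff Un_Diff)
    then have e_d: "map ?e (d # us) = ts"
      using e_id[OF ts(1)] by (simp add: split)
    have len: "length (d # us) = length \<pi>s"
      using ts(2) by (simp add: split)
    obtain ts' where ts': "ts' \<in> lists ?T'" "length ts' = length \<pi>s'"
      and sat: "qfree_sat (?\<Pi> (d # us) ts') 0 (Imp ?G \<phi>)"
      using R[rule_format, of "d # us"] len e_d ts(1) in_T'[of "d # us"] by auto
    have "p \<notin> t i" for i
      using erase_traces[OF fresh(1), of t] ts(1)
      by (auto simp: split erase_def dest: fun_cong[of _ _ i])
    then have "p \<in> d i \<longleftrightarrow> qfree_sat (Map.empty(\<pi>s [\<mapsto>] ts)) i \<psi>" for i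
      by (simp add: d_def)
    \<comment> \<open>By distinctness, no later variable of either block overwrites the first
      one.\<close>
    moreover have "?\<Pi> (d # us) ts' \<pi> = Some d"
      using assms(5) by (simp add: split)
    moreover have "qfree_sat (Map.empty(\<pi>s [\<mapsto>] ts)) i \<psi> \<longleftrightarrow> qfree_sat (?\<Pi> ts (map ?e ts')) i \<psi>" for i
      using assms(5,9) by (intro qfree_sat_cong) (auto simp: subset_iff disjoint_iff)
    \<comment> \<open>\<open>\<psi>\<close> does not mention \<open>p\<close>, so its value under
      the decorated tuple is the one that was used to define \<open>d\<close>.\<close>
    ultimately have "qfree_sat (?\<Pi> (d # us) ts') 0 ?G"
      using sat_e[OF len ts'(2) fresh(3)] unfolding e_d by (simp add: split)
    with sat have "qfree_sat (?\<Pi> ts (map ?e ts')) 0 \<phi>"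
      using sat_e[OF len ts'(2) fresh(2)] unfolding e_d by simp
    \<comment> \<open>The witnesses obtained may contain \<open>p\<close>; their erasures are traces
      of \<open>S\<close> and still satisfy \<open>\<phi>\<close>.\<close>
    with ts' show "\<exists>ts'\<in>lists ?T. length ts' = length \<pi>s' \<and> qfree_sat (?\<Pi> ts ts') 0 \<phi>"
      using in_T' by (intro bexI[of _ "map ?e ts'"]) auto
  qed
  then show ?thesis
    by (simp add: models_def sat_Foralls sat_Existss)
qed

end
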